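(* Let $(G,u)\in\mathbf{W}$, i.e. $G$ is an archimedean $\ell$-group and $u\ge 0$ is a distinguished weak unit of $G$. The following statements are equivalent. (1) $G\in(\mathrm{M})$. (2) $(G,u)\in\mathbf{W}^*$ (i.e. $u$ is a strong unit of $G$) and the Yosida embedding $G\le C(YG)$ has the property that for any $a,b\ge 0$ in $G$, if $\mathrm{coz}(b)\subseteq\mathrm{cl}\,\mathrm{coz}(a)$, then $b\in G(a)$. (3) $G\in(\mathrm{Y})$ and $\mathrm{Max}(G)\subseteq\mathrm{Spec}_d(G)$. (4) $G\in(\mathrm{Y})$ and every weak unit of $G$ is a strong unit of $G$.
   Context: $\ell$-group means lattice-ordered group (written additively). $G$ is archimedean if $a,b\ge 0$ and $na\le b$ for all $n\in\mathbb{N}$ imply $a=0$. For $a\in G$, $G(a)=\{b\in G:|b|\le n|a|\text{ for some }n\in\mathbb{N}\}$; for $S\subseteq G$, $S^\perp=\{h\in G:|h|\wedge|s|=0\text{ for all }s\in S\}$. A weak unit is $u\ge 0$ with $u^\perp=\{0\}$; a strong unit is $u\ge 0$ with $G(u)=G$. $\mathrm{Max}(G)$ is the set of maximal (proper) convex $\ell$-subgroups of $G$. A convex $\ell$-subgroup $H$ is a $d$-subgroup if $a^{\perp\perp}\subseteq H$ for all $a\in H$. $\mathrm{Spec}_d(G)$ is the set of proper prime subgroups of $G$ (proper convex $\ell$-subgroups $p$ such that $a\wedge b=0$ implies $a\in p$ or $b\in p$) that are $d$-subgroups. $G\in(\mathrm{M})$ means every convex $\ell$-subgroup of $G$ is a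 $d$-subgroup (equivalently $G(a)=a^{\perp\perp}$ for all $a\in G$). $G\in(\mathrm{Y})$ means that for every $a\in G$, $G(a)$ is an intersection of members of $\mathrm{Max}(G)$ (the empty intersection being $G$). The Yosida space $YG=Y(G,u)$ is the set of convex $\ell$-subgroups of $G$ maximal with respect to not containing $u$, with the hull-kernel topology (base: the sets $\{p\in YG:a\notin p\}$, $a\in G$); it is compact Hausdorff. The Yosida embedding theorem represents $G$, via an injective $\ell$-homomorphism taking $u$ to the constant function $\mathbf{1}$, as an $\ell$-group of continuous functions $YG\to\mathbb{R}\cup\{\pm\infty\}$ that are real-valued on a dense set, such that for each $p\in YG$ and closed $V\subseteq YG$ with $p\notin V$ some $a\in G$ has $a(p)=0$ and $a(q)=1$ for all $q\in V$; when $u$ is a strong unit, all these functions are real-valued, so $G\le C(YG)$. Identifying $G$ with its image, $\mathrm{coz}(a)=\{p\in YG:a(p)\neq 0\}$ (equivalently $\{p\in YG: a\notin p\}$ when $u$ is a strong unit), and $\mathrm{cl}$ is closure in $YG$. *)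

theory Defs
  imports "HOL-Analysis.Analysis"
begin

text \<open>
  Lattice-ordered groups, written additively but not assumed to be commutative
  (so \<open>lattice_ab_group_add\<close> is not used).
\<close>

class lgroup = group_add + lattice +
  assumes lgroup_add_left_mono: "a \<le> b \<Longrightarrow> c + a \<le> c + b"
    and lgroup_add_right_mono: "a \<le> b \<Longrightarrow> a + c \<le> b + c"

primrec nmult :: "nat \<Rightarrow> 'a::group_add \<Rightarrow> 'a" where
  "nmult 0 a = 0"
| "nmult (Suc n) a = a + nmult n a"

definition zmult :: "int \<Rightarrow> 'a::group_add \<Rightarrow> 'a" where
  "zmult m a = (if 0 \<le> m then nmult (nat m) a else - nmult (nat (- m)) a)"

definition archimedean :: "'a::lgroup itself \<Rightarrow> bool" where
  "archimedean _ \<longleftrightarrow>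
     (\<forall>a b::'a. 0 \<le> a \<longrightarrow> 0 \<le> b \<longrightarrow> (\<forall>n. nmult n a \<le> b) \<longrightarrow> a = 0)"

definition labs :: "'a::lgroup \<Rightarrow> 'a" where
  "labs a = sup a (- a)"

definition principal_lsub :: "'a::lgroup \<Rightarrow> 'a set" where
  "principal_lsub a = {b. \<exists>n. labs b \<le> nmult n (labs a)}"

definition polar :: "'a::lgroup set \<Rightarrow> 'a set" where
  "polar S = {h. \<forall>s\<in>S. inf (labs h) (labs s) = 0}"

definition weak_unit :: "'a::lgroup \<Rightarrow> bool" where
  "weak_unit u \<longleftrightarrow> 0 \<le> u \<and> polar {u} = {0}"

definition strong_unit :: "'a::lgroup \<Rightarrow> bool" where
  "strong_unit u \<longleftrightarrow> 0 \<le> u \<and> principal_lsub u = UNIV"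

definition convex_lsubgroup :: "'a::lgroup set \<Rightarrow> bool" where
  "convex_lsubgroup H \<longleftrightarrow>
     0 \<in> H \<and>
     (\<forall>a\<in>H. \<forall>b\<in>H. a + b \<in> H) \<and>
     (\<forall>a\<in>H. - a \<in> H) \<and>
     (\<forall>a\<in>H. \<forall>b\<in>H. sup a b \<in> H \<and> inf a b \<in> H) \<and>
     (\<forall>a\<in>H. \<forall>b\<in>H. \<forall>x. a \<le> x \<longrightarrow> x \<le> b \<longrightarrow> x \<in> H)"

definition d_subgroup :: "'a::lgroup set \<Rightarrow> bool" where
  "d_subgroup H \<longleftrightarrow> convex_lsubgroup H \<and> (\<forall>a\<in>H. polar (polar {a}) \<subseteq> H)"

definition prime_subgroup :: "'a::lgroup set \<Rightarrow> bool" where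
  "prime_subgroup p \<longleftrightarrow>
     convex_lsubgroup p \<and> p \<noteq> UNIV \<and> (\<forall>a b. inf a b = 0 \<longrightarrow> a \<in> p \<or> b \<in> p)"

definition Spec_d :: "'a::lgroup set set" where
  "Spec_d = {p. prime_subgroup p \<and> d_subgroup p}"

definition Max_lsub :: "'a::lgroup set set" where
  "Max_lsub = {p. convex_lsubgroup p \<and> p \<noteq> UNIV \<and>
     (\<forall>q. convex_lsubgroup q \<longrightarrow> p \<subset> q \<longrightarrow> q = UNIV)}"

definition property_M :: "'a::lgroup itself \<Rightarrow> bool" where
  "property_M _ \<longleftrightarrow> (\<forall>H::'a set. convex_lsubgroup H \<longrightarrow> d_subgroup H)"

text \<open>The empty family is allowed below; its intersection is the whole group.\<close>

definition property_Y :: "'a::lgroup itself \<Rightarrow> bool" where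
  "property_Y _ \<longleftrightarrow> (\<forall>a::'a. \<exists>F\<subseteq>Max_lsub. principal_lsub a = \<Inter>F)"

definition YG :: "'a::lgroup \<Rightarrow> 'a set set" where
  "YG u = {p. convex_lsubgroup p \<and> u \<notin> p \<and>
     (\<forall>q. convex_lsubgroup q \<longrightarrow> p \<subset> q \<longrightarrow> u \<in> q)}"

definition yosida_space :: "'a::lgroup \<Rightarrow> 'a set topology" where
  "yosida_space u = topology_generated_by {{p \<in> YG u. a \<notin> p} | a. True}"

lemma topspace_yosida_space [simp]: "topspace (yosida_space u) = YG u"
  by (auto simp: yosida_space_def YG_def)

text \<open>
  The Yosida embedding sends \<open>a\<close> to the function \<open>yosida u a\<close> on \<open>YG u\<close>.
  For \<open>p \<in> YG u\<close> the quotient of the group by \<open>p\<close> is totally ordered, and the value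
  of \<open>a\<close> at \<open>p\<close> is obtained as in Hoelder's theorem, normalised so that the class of
  \<open>u\<close> goes to 1: it is the supremum of the rationals \<open>m / n\<close> with \<open>n > 0\<close> and
  \<open>m u \<le> n a\<close> modulo \<open>p\<close>, where \<open>x \<le> y\<close> modulo \<open>p\<close> means that the positive part of
  \<open>x - y\<close> belongs to \<open>p\<close>. The value is \<open>\<infinity>\<close> or \<open>-\<infinity>\<close> when
  all, respectively no, such rationals occur.
\<close>

definition yosida :: "'a::lgroup \<Rightarrow> 'a \<Rightarrow> 'a set \<Rightarrow> ereal" where
  "yosida u a p =
     Sup {ereal (real_of_int m / real n) | m n.
            0 < n \<and> sup (zmult m u - nmult n a) 0 \<in> p}"

definition coz :: "'a::lgroup \<Rightarrow> 'a \<Rightarrow> 'a set set" where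
  "coz u a = {p \<in> YG u. yosida u a p \<noteq> 0}"

end

theory Submission
  imports Defs
begin

text \<open>
  For \<open>a \<ge> 0\<close> the zeros of \<open>a\<close> in \<open>YG\<close> are the values of \<open>u\<close> containing \<open>a\<close>, and by the
  archimedean property the values of the weak unit \<open>u\<close> intersect in \<open>0\<close>. Hence \<open>coz(b) \<subseteq> cl coz(a)\<close>
  says exactly that \<open>b \<in> a\<^sup>\<bottom>\<^sup>\<bottom>\<close>, and (2) becomes \<open>G(a) = a\<^sup>\<bottom>\<^sup>\<bottom>\<close> together with \<open>u\<close> being strong.
  Then the maximal convex subgroups are the values of \<open>u\<close>; they are prime and separate \<open>a\<^sup>\<bottom>\<^sup>\<bottom>\<close> from
  the elements outside it, which gives (3). A maximal d-subgroup contains no weak unit, so (3) implies (4).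
  Finally, if \<open>b \<in> a\<^sup>\<bottom>\<^sup>\<bottom>\<close> lies outside a maximal subgroup containing \<open>a\<close>, that subgroup contains a weak
  unit, contradicting (4). Commutativity is not assumed but derived from the archimedean property.
\<close>

section \<open>Lattice-ordered groups\<close>

lemma lgroup_add_le_cancel_left [simp]: "c + a \<le> c + b \<longleftrightarrow> a \<le> b" for a b c :: "'a::lgroup"
  using lgroup_add_left_mono[of a b c] lgroup_add_left_mono[of "c + a" "c + b" "- c"]
  by (auto simp: add.assoc[symmetric])

lemma lgroup_add_le_cancel_right [simp]: "a + c \<le> b + c \<longleftrightarrow> a \<le> b" for a b c :: "'a::lgroup"
  using lgroup_add_right_mono[of a b c] lgroup_add_right_mono[of "a + c" "b + c" "- c"]
  by (auto simp: add.assoc)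

lemma lgroup_add_mono: "a \<le> b \<Longrightarrow> c \<le> d \<Longrightarrow> a + c \<le> b + d" for a b c d :: "'a::lgroup"
  by (meson lgroup_add_left_mono lgroup_add_right_mono order_trans)

lemma lgroup_add_nonneg: "0 \<le> a \<Longrightarrow> 0 \<le> b \<Longrightarrow> 0 \<le> a + b" for a b :: "'a::lgroup"
  using lgroup_add_mono[of 0 a 0 b] by simp

lemma lgroup_le_add_right: "0 \<le> b \<Longrightarrow> a \<le> a + b" for a b :: "'a::lgroup"
  using lgroup_add_left_mono[of 0 b a] by simp

lemma lgroup_le_add_left: "0 \<le> b \<Longrightarrow> a \<le> b + a" for a b :: "'a::lgroup"
  using lgroup_add_right_mono[of 0 b a] by simp

lemma lgroup_neg_le_iff [simp]: "- a \<le> - b \<longleftrightarrow> b \<le> a" for a b :: "'a::lgroup"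
proof -
  have *: "- a \<le> - b" if "b \<le> a" for a b :: 'a
  proof -
    have "- a + b \<le> 0" using lgroup_add_left_mono[OF that, of "- a"] by simp
    from lgroup_add_right_mono[OF this, of "- b"] show ?thesis by simp
  qed
  show ?thesis using *[of b a] *[of "- a" "- b"] by auto
qed

lemma lgroup_le_diff_iff: "a \<le> b - c \<longleftrightarrow> a + c \<le> b" for a b c :: "'a::lgroup"
  using lgroup_add_le_cancel_right[of a c "b - c"] by simp

lemma lgroup_diff_le_iff: "a - c \<le> b \<longleftrightarrow> a \<le> b + c" for a b c :: "'a::lgroup"
  using lgroup_add_le_cancel_right[of "a - c" c b] by simp

lemma lgroup_uminus_add_le_iff: "- c + a \<le> b \<longleftrightarrow> a \<le> c + b" for a b c :: "'a::lgroup"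
  using lgroup_add_le_cancel_left[of c "- c + a" b] by (simp add: add.assoc[symmetric])

lemma lgroup_le_uminus_add_iff: "a \<le> - c + b \<longleftrightarrow> c + a \<le> b" for a b c :: "'a::lgroup"
  using lgroup_add_le_cancel_left[of c a "- c + b"] by (simp add: add.assoc[symmetric])

lemma lgroup_neg_nonpos_iff [simp]: "- a \<le> 0 \<longleftrightarrow> 0 \<le> a" for a :: "'a::lgroup"
  using lgroup_neg_le_iff[of a 0] by simp

lemma lgroup_diff_nonneg_le: "0 \<le> b \<Longrightarrow> a - b \<le> a" for a b :: "'a::lgroup"
  by (simp add: lgroup_diff_le_iff lgroup_le_add_right)

lemma lgroup_add_sup_left: "c + sup a b = sup (c + a) (c + b)" for a b c :: "'a::lgroup"
proof (rule order.antisym)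
  have "a \<le> - c + sup (c + a) (c + b)" "b \<le> - c + sup (c + a) (c + b)"
    by (simp_all add: lgroup_le_uminus_add_iff)
  then have "sup a b \<le> - c + sup (c + a) (c + b)" by simp
  then show "c + sup a b \<le> sup (c + a) (c + b)"
    by (simp add: lgroup_le_uminus_add_iff)
qed simp

lemma lgroup_add_sup_right: "sup a b + c = sup (a + c) (b + c)" for a b c :: "'a::lgroup"
proof (rule order.antisym)
  have "a \<le> sup (a + c) (b + c) - c" "b \<le> sup (a + c) (b + c) - c"
    by (simp_all only: lgroup_le_diff_iff) simp_all
  then have "sup a b \<le> sup (a + c) (b + c) - c" by simp
  then show "sup a b + c \<le> sup (a + c) (b + c)"
    by (simp only: lgroup_le_diff_iff)
qed simp

lemma lgroup_add_inf_left: "c + inf a b = inf (c + a) (c + b)" for a b c :: "'a::lgroup"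
proof (rule order.antisym)
  have "- c + inf (c + a) (c + b) \<le> a" "- c + inf (c + a) (c + b) \<le> b"
    by (simp_all add: lgroup_uminus_add_le_iff)
  then have "- c + inf (c + a) (c + b) \<le> inf a b" by simp
  then show "inf (c + a) (c + b) \<le> c + inf a b"
    by (simp only: lgroup_uminus_add_le_iff)
qed simp

lemma lgroup_add_inf_right: "inf a b + c = inf (a + c) (b + c)" for a b c :: "'a::lgroup"
proof (rule order.antisym)
  have "inf (a + c) (b + c) - c \<le> a" "inf (a + c) (b + c) - c \<le> b"
    by (simp_all only: lgroup_diff_le_iff) simp_all
  then have "inf (a + c) (b + c) - c \<le> inf a b" by simp
  then show "inf (a + c) (b + c) \<le> inf a b + c"
    by (simp only: lgroup_diff_le_iff)
qed simp

lemma lgroup_uminus_inf: "- inf a b = sup (- a) (- b)" for a b :: "'a::lgroup"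
proof (rule order.antisym)
  have "- sup (- a) (- b) \<le> a" "- sup (- a) (- b) \<le> b"
    using lgroup_neg_le_iff[of "sup (- a) (- b)" "- a"] lgroup_neg_le_iff[of "sup (- a) (- b)" "- b"]
    by simp_all
  then have "- sup (- a) (- b) \<le> inf a b" by simp
  then show "- inf a b \<le> sup (- a) (- b)"
    using lgroup_neg_le_iff[of "inf a b" "- sup (- a) (- b)"] by simp
qed simp

lemma lgroup_uminus_sup: "- sup a b = inf (- a) (- b)" for a b :: "'a::lgroup"
  using lgroup_uminus_inf[of "- a" "- b"] by (metis minus_minus)

text \<open>Distributing addition over both meets turns the right side into the meet of
  \<open>x + x\<close>, \<open>y + x\<close>, \<open>x + z\<close> and \<open>y + z\<close>; the
  first three are above \<open>x\<close> by positivity.\<close>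

lemma lgroup_inf_add_le:
  fixes x y z :: "'a::lgroup"
  assumes "0 \<le> x" "0 \<le> y" "0 \<le> z"
  shows "inf x (y + z) \<le> inf x y + inf x z"
proof -
  have "inf x y + inf x z = inf (inf (x + x) (y + x)) (inf (x + z) (y + z))"
    by (simp add: lgroup_add_inf_left lgroup_add_inf_right)
  moreover have "x \<le> x + x" "x \<le> y + x" "x \<le> x + z"
    using assms by (simp_all add: lgroup_le_add_left lgroup_le_add_right)
  ultimately show ?thesis by (simp add: le_infI1)
qed

lemma lgroup_disjoint_add:
  fixes x y z :: "'a::lgroup"
  assumes "inf x y = 0" "inf x z = 0"
  shows "inf x (y + z) = 0"
proof -
  have p: "0 \<le> x" "0 \<le> y" "0 \<le> z"
    using assms by (metis inf.cobounded1 inf.cobounded2)+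
  show ?thesis
    using lgroup_inf_add_le[OF p] assms p
    by (intro order.antisym) (simp_all add: lgroup_add_nonneg)
qed

lemma lgroup_disjoint_mono:
  fixes x y z :: "'a::lgroup"
  assumes "inf x y = 0" "0 \<le> z" "z \<le> y"
  shows "inf x z = 0"
proof (rule order.antisym)
  show "inf x z \<le> 0" using inf_mono[OF order_refl assms(3), of x] assms(1) by simp
  have "0 \<le> x" using assms(1) by (metis inf.cobounded1)
  then show "0 \<le> inf x z" using assms(2) by simp
qed

text \<open>For \<open>m = inf x 0\<close>, the sum \<open>m + m\<close> is the meet of
  \<open>x + x\<close>, \<open>x\<close> and \<open>0\<close>; the first term is absorbed, so
  \<open>m + m = m\<close> and \<open>m = 0\<close>.\<close>

lemma lgroup_nonneg_if_double: "0 \<le> x + x \<Longrightarrow> 0 \<le> x" for x :: "'a::lgroup"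
proof -
  assume a: "0 \<le> x + x"
  have "inf x 0 + inf x 0 = inf (inf (x + x) 0) x"
    by (simp add: lgroup_add_inf_left lgroup_add_inf_right inf_commute inf_left_commute inf_assoc)
  also have "\<dots> = inf x 0" using a by (simp add: inf_absorb1 inf_commute)
  finally have "inf x 0 = 0" using add_left_cancel[of "inf x 0" "inf x 0" 0] by simp
  then show "0 \<le> x" by (metis inf.cobounded1)
qed

section \<open>Absolute values, positive and negative parts\<close>

lemma le_labs: "a \<le> labs a" and neg_le_labs: "- a \<le> labs a" for a :: "'a::lgroup"
  by (simp_all add: labs_def)

lemma labs_nonneg [simp]: "0 \<le> labs a" for a :: "'a::lgroup"
proof (rule lgroup_nonneg_if_double)
  show "0 \<le> labs a + labs a"
    using lgroup_add_mono[OF le_labs[of a] neg_le_labs[of a]] by simp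
qed

lemma labs_of_nonneg [simp]: "0 \<le> a \<Longrightarrow> labs a = a" for a :: "'a::lgroup"
  unfolding labs_def by (rule sup_absorb1) (metis lgroup_neg_nonpos_iff order_trans)

lemma labs_uminus [simp]: "labs (- a) = labs a" for a :: "'a::lgroup"
  by (simp add: labs_def sup_commute)

lemma labs_le_iff: "labs a \<le> b \<longleftrightarrow> a \<le> b \<and> - a \<le> b" for a :: "'a::lgroup"
  by (simp add: labs_def)

lemma labs_eq_0_iff [simp]: "labs a = 0 \<longleftrightarrow> a = 0" for a :: "'a::lgroup"
  using le_labs[of a] neg_le_labs[of a] by (auto intro: order.antisym)

text \<open>Without commutativity \<open>labs a + labs b\<close> bounds \<open>a + b\<close>, but
  the negative \<open>- b - a\<close> is bounded by \<open>labs b + labs a\<close>. The three-term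
  sum dominates both.\<close>

lemma labs_add_le: "labs (a + b) \<le> labs a + labs b + labs a" for a b :: "'a::lgroup"
  unfolding labs_le_iff minus_add
proof
  have "a + b \<le> labs a + labs b" by (simp add: lgroup_add_mono le_labs)
  also have "\<dots> \<le> labs a + labs b + labs a" by (simp add: lgroup_le_add_right)
  finally show "a + b \<le> labs a + labs b + labs a" .
  have "- b - a \<le> labs b + labs a"
    using lgroup_add_mono[OF neg_le_labs[of b] neg_le_labs[of a]] by simp
  also have "\<dots> \<le> labs a + labs b + labs a" by (simp add: lgroup_le_add_left add.assoc)
  finally show "- b + - a \<le> labs a + labs b + labs a" by simp
qed

lemma lgroup_pos_neg_eq: "a + sup (- a) 0 = sup a 0" for a :: "'a::lgroup"
  by (simp add: lgroup_add_sup_left sup_commute)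

lemma lgroup_pos_neg_disjoint: "inf (sup a 0) (sup (- a) 0) = 0" for a :: "'a::lgroup"
proof -
  have "inf (sup a 0) (sup (- a) 0) = inf a 0 + sup (- a) 0"
    using lgroup_pos_neg_eq[of a] by (simp add: lgroup_add_inf_right)
  also have "\<dots> = 0" by (metis lgroup_uminus_inf minus_zero right_minus)
  finally show ?thesis .
qed

section \<open>Natural multiples and disjointness\<close>

lemma nmult_commute: "a + nmult n a = nmult n a + a"
  by (induction n) (simp_all add: add.assoc[symmetric])

lemma nmult_add: "nmult (m + n) a = nmult m a + nmult n a"
  by (induction m) (simp_all add: add.assoc)

lemma nmult_nonneg [simp]: "0 \<le> a \<Longrightarrow> 0 \<le> nmult n a" for a :: "'a::lgroup"
  by (induction n) (simp_all add: lgroup_add_nonneg)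

lemma nmult_conj: "nmult n (- g + a + g) = - g + nmult n a + g"
  by (induction n) (simp_all add: add.assoc[symmetric])

lemma nmult_disjoint: "inf x y = 0 \<Longrightarrow> inf x (nmult n y) = 0" for x y :: "'a::lgroup"
proof (induction n)
  case 0
  then have "0 \<le> x" by (metis inf.cobounded1)
  then show ?case by (simp add: inf_absorb2)
qed (simp add: lgroup_disjoint_add)

text \<open>Discards an error term \<open>y\<close> disjoint from \<open>x\<close>; this brings
  bounds on multiples into the form that the archimedean property requires.\<close>

lemma lgroup_le_of_le_disjoint_add:
  fixes x y z :: "'a::lgroup"
  assumes "0 \<le> z" "inf x y = 0" "x \<le> y + z"
  shows "x \<le> z"
proof -
  have p: "0 \<le> x" "0 \<le> y" using assms by (metis inf.cobounded1 inf.cobounded2)+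
  have "x = inf x (y + z)" using assms by (simp add: inf_absorb1)
  also have "\<dots> \<le> inf x y + inf x z" using lgroup_inf_add_le p assms by blast
  also have "\<dots> \<le> z" using assms by simp
  finally show ?thesis .
qed

section \<open>Commutativity of archimedean l-groups\<close>

text \<open>With \<open>d = x + c - x\<close> one has \<open>n c \<le> x + n c = n d + x\<close>, and \<open>n c\<close> is disjoint from \<open>n d\<close>.\<close>

lemma archimedean_conj_disjoint:
  fixes c x :: "'a::lgroup"
  assumes arch: "archimedean TYPE('a)" and x: "0 \<le> x" and dis: "inf c (x + c - x) = 0"
  shows "c = 0"
proof -
  have c: "0 \<le> c" using dis by (metis inf.cobounded1)
  have "nmult n c \<le> x" for n
  proof (rule lgroup_le_of_le_disjoint_add[OF x])
    have "inf (nmult n c) (x + c - x) = 0" using nmult_disjoint dis inf_commute by metis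
    then show "inf (nmult n c) (nmult n (x + c - x)) = 0" by (rule nmult_disjoint)
    have "nmult n (x + c - x) + x = x + nmult n c"
      using nmult_conj[of n "- x" c] by simp
    then show "nmult n c \<le> nmult n (x + c - x) + x"
      using x by (simp add: lgroup_le_add_left)
  qed
  then show ?thesis using arch c x unfolding archimedean_def by blast
qed

lemma conj_le_iff: "g + a - g \<le> b \<longleftrightarrow> a \<le> - g + b + g" for a b g :: "'a::lgroup"
  by (simp add: lgroup_diff_le_iff lgroup_le_uminus_add_iff add.assoc)

lemma conj_inf: "- g + inf a b + g = inf (- g + a + g) (- g + b + g)" for a b g :: "'a::lgroup"
  by (simp add: lgroup_add_inf_left lgroup_add_inf_right)

text \<open>For \<open>x \<ge> 0\<close>, the meet \<open>c\<close> of \<open>h\<close> and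
  \<open>- x + k + x\<close> is below \<open>h\<close>, while \<open>x + c - x\<close> is below
  \<open>k\<close>. So \<open>c\<close> is disjoint from its conjugate and vanishes. Conjugating
  back treats \<open>- x\<close>, and every \<open>g\<close> is a difference of two nonnegative
  elements.\<close>

lemma archimedean_disjoint_conj:
  fixes g h k :: "'a::lgroup"
  assumes arch: "archimedean TYPE('a)" and dis: "inf h k = 0"
  shows "inf h (- g + k + g) = 0"
proof -
  have pos: "inf h (- x + k + x) = 0" if dis: "inf h k = 0" and x: "0 \<le> x" for h k x :: 'a
  proof (rule archimedean_conj_disjoint[OF arch x])
    let ?c = "inf h (- x + k + x)"
    have h: "0 \<le> h" "0 \<le> k" using dis by (metis inf.cobounded1 inf.cobounded2)+
    have "0 \<le> ?c" using h lgroup_add_mono[of 0 k "- x" "- x"]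
      by (simp add: lgroup_le_uminus_add_iff[of 0 x] add.assoc lgroup_le_add_left)
    moreover have "?c \<le> - x + k + x" by simp
    then have "x + ?c - x \<le> k" by (simp only: conj_le_iff)
    moreover have "0 \<le> x + ?c - x"
      using \<open>0 \<le> ?c\<close> by (simp only: lgroup_le_diff_iff) (simp add: lgroup_le_add_right)
    ultimately show "inf ?c (x + ?c - x) = 0"
      using dis by (metis inf.cobounded1 inf_commute lgroup_disjoint_mono)
  qed
  have neg: "inf h (x + k - x) = 0" if dis: "inf h k = 0" and x: "0 \<le> x" for h k x :: 'a
  proof -
    have "inf k (- x + h + x) = 0" using pos[of k h x] dis x by (simp add: inf_commute)
    then have "x + inf k (- x + h + x) - x = 0" by simp
    then show ?thesis using conj_inf[of "- x" k "- x + h + x"]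
      by (simp add: inf_commute add.assoc[symmetric])
  qed
  have "g = sup g 0 - sup (- g) 0" using lgroup_pos_neg_eq[of g] by (metis add_diff_cancel)
  then obtain x y where g: "g = x - y" and xy: "0 \<le> x" "0 \<le> y" by (metis sup.cobounded2)
  have "inf h (y + (- x + k + x) - y) = 0" using neg pos dis xy by blast
  then show ?thesis unfolding g by (simp add: add.assoc[symmetric] add_diff_eq)
qed

text \<open>An inequality up to a one-sided error from \<open>P\<close>. In the applications
  \<open>P\<close> is the positive cone of the polar of some \<open>k\<close>, so this plays the
  role of "x is below y wherever k is nonzero" before any representation by functions is
  available.\<close>

definition le_mod :: "'a::lgroup set \<Rightarrow> 'a \<Rightarrow> 'a \<Rightarrow> bool" where
  "le_mod P x y \<longleftrightarrow> (\<exists>q\<in>P. x \<le> q + y)"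

locale normal_subset =
  fixes P :: "'a::lgroup set"
  assumes zero: "0 \<in> P" and add: "a \<in> P \<Longrightarrow> b \<in> P \<Longrightarrow> a + b \<in> P"
    and conj: "a \<in> P \<Longrightarrow> - g + a + g \<in> P"
begin

lemma le_modI: "x \<le> y \<Longrightarrow> le_mod P x y"
  unfolding le_mod_def using zero by (intro bexI[of _ 0]) auto

lemma le_mod_trans [trans]: "le_mod P x y \<Longrightarrow> le_mod P y z \<Longrightarrow> le_mod P x z"
proof -
  assume "le_mod P x y" "le_mod P y z"
  then obtain q r where *: "q \<in> P" "r \<in> P" "x \<le> q + y" "y \<le> r + z"
    unfolding le_mod_def by blast
  then have "x \<le> (q + r) + z"
    by (metis add.assoc lgroup_add_left_mono order_trans)
  then show ?thesis unfolding le_mod_def using * add by blast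
qed

lemma le_mod_right: "le_mod P (x + w) (y + w) \<longleftrightarrow> le_mod P x y"
  unfolding le_mod_def by (simp add: add.assoc[symmetric])

lemma le_mod_left: "le_mod P (w + x) (w + y) \<longleftrightarrow> le_mod P x y"
proof -
  have *: "le_mod P (w + x) (w + y)" if le: "le_mod P x y" for w x y
  proof -
    obtain q where q: "q \<in> P" "x \<le> q + y" using le unfolding le_mod_def by blast
    have "w + x \<le> (w + q - w) + (w + y)"
      using lgroup_add_left_mono[OF q(2), of w] by (simp add: add.assoc[symmetric])
    then show ?thesis unfolding le_mod_def using conj[OF q(1), of "- w"] by auto
  qed
  show ?thesis using *[of x y w] *[of "w + x" "w + y" "- w"] by (auto simp: add.assoc[symmetric])
qed

lemma le_mod_add: "le_mod P a b \<Longrightarrow> le_mod P c d \<Longrightarrow> le_mod P (a + c) (b + d)"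
  using le_mod_trans le_mod_left le_mod_right by metis

lemma le_mod_nmult: "le_mod P a b \<Longrightarrow> le_mod P (nmult n a) (nmult n b)"
  by (induction n) (simp_all add: le_modI le_mod_add)

text \<open>Each induction step wraps one \<open>z\<close> on the left and one \<open>e\<close> on
  the right around \<open>n (e + z)\<close>. Regrouping makes this \<open>(n + 1) (z + e)\<close>,
  and the hypothesis exchanges the two summands in every copy.\<close>

lemma le_mod_nmult_add:
  assumes "le_mod P (z + e) (e + z)"
  shows "le_mod P (nmult n z + nmult n e) (nmult n (e + z))"
proof (induction n)
  case 0
  then show ?case by (simp add: le_modI)
next
  case (Suc n)
  have shift: "nmult n (e + z) + e = e + nmult n (z + e)" for n
    by (induction n) (simp_all add: add.assoc)
  have "nmult (Suc n) z + nmult (Suc n) e = z + (nmult n z + nmult n e) + e"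
    using nmult_commute[of e n] by (simp add: add.assoc)
  also have "le_mod P \<dots> (z + nmult n (e + z) + e)"
    using Suc le_mod_left le_mod_right by blast
  also have "z + nmult n (e + z) + e = nmult (Suc n) (z + e)"
    using shift[of n] by (simp add: add.assoc)
  also have "le_mod P \<dots> (nmult (Suc n) (e + z))"
    using assms by (rule le_mod_nmult)
  finally show ?case .
qed

end

lemma archimedean_normal_polar:
  fixes k :: "'a::lgroup"
  assumes arch: "archimedean TYPE('a)" and k: "0 \<le> k"
  shows "normal_subset {q. 0 \<le> q \<and> inf k q = 0}"
proof
  show "0 \<in> {q. 0 \<le> q \<and> inf k q = 0}" using k by (simp add: inf_absorb2)
  show "a + b \<in> {q. 0 \<le> q \<and> inf k q = 0}"
    if "a \<in> {q. 0 \<le> q \<and> inf k q = 0}" "b \<in> {q. 0 \<le> q \<and> inf k q = 0}" for a b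
    using that by (simp add: lgroup_disjoint_add lgroup_add_nonneg)
  show "- g + a + g \<in> {q. 0 \<le> q \<and> inf k q = 0}"
    if "a \<in> {q. 0 \<le> q \<and> inf k q = 0}" for a g
  proof -
    have *: "inf k (- g + a + g) = 0" using that archimedean_disjoint_conj[OF arch] by simp
    then have "0 \<le> - g + a + g" by (metis inf.cobounded2)
    with * show ?thesis by simp
  qed
qed

text \<open>
  Put \<open>z = x + c\<close> and \<open>e = - c + x + c - x\<close>. Then \<open>- c + z + c = e + z\<close> and \<open>x + z - x = z + e\<close>.
  Where \<open>z + e \<le> e + z\<close>, the first identity gives \<open>n z + n e \<le> n (e + z) \<le> n z + c\<close>, and where
  \<open>e + z \<le> z + e\<close>, the second gives \<open>n e + n z \<le> n (z + e) \<le> x + n z\<close>. Working modulo normal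
  polars makes "where" precise.
\<close>

lemma archimedean_commutator_nonpos:
  fixes c x :: "'a::lgroup"
  assumes arch: "archimedean TYPE('a)" and c: "0 \<le> c" and x: "0 \<le> x"
  shows "- c + x + c - x \<le> 0"
proof -
  define e where "e = - c + x + c - x"
  define z where "z = x + c"
  define s where "s = (e + z) - (z + e)"
  have vanish: "k = 0"
    if k: "0 \<le> k" "k \<le> sup e 0"
      and y: "0 \<le> y" "\<And>n. le_mod {q. 0 \<le> q \<and> inf k q = 0} (nmult n e) y" for k y
  proof -
    let ?P = "{q. 0 \<le> q \<and> inf k q = 0}"
    interpret normal_subset ?P using arch k(1) by (rule archimedean_normal_polar)
    have "inf (sup (- e) 0) k = 0"
      using lgroup_disjoint_mono[of "sup (- e) 0" "sup e 0" k] k lgroup_pos_neg_disjoint[of e]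
      by (simp add: inf_commute)
    then have "sup (- e) 0 \<in> ?P" by (simp add: inf_commute)
    moreover have "sup e 0 = sup (- e) 0 + e" by (simp add: lgroup_add_sup_right sup_commute)
    ultimately have "le_mod ?P k e" unfolding le_mod_def using k(2) by (intro bexI) auto
    then have "le_mod ?P (nmult n k) y" for n using le_mod_nmult le_mod_trans y(2) by blast
    then obtain q where q: "\<And>n. q n \<in> ?P \<and> nmult n k \<le> q n + y" unfolding le_mod_def by metis
    have "nmult n k \<le> y" for n
    proof (rule lgroup_le_of_le_disjoint_add[OF y(1)])
      show "inf (nmult n k) (q n) = 0"
        using q[of n] nmult_disjoint[of "q n" k n] by (simp add: inf_commute)
      show "nmult n k \<le> q n + y" using q by blast
    qed
    then show "k = 0" using arch k y(1) unfolding archimedean_def by blast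
  qed
  \<comment> \<open>The case "e + z below z + e": on the part \<open>?k\<close> under the negative
    part of \<open>s\<close>, the positive part of \<open>s\<close> is an element of the polar and
    hence negligible.\<close>
  have "inf (sup e 0) (sup (- s) 0) = 0"
  proof (rule vanish[of _ x])
    let ?k = "inf (sup e 0) (sup (- s) 0)"
    let ?P = "{q. 0 \<le> q \<and> inf ?k q = 0}"
    show k: "0 \<le> ?k" "?k \<le> sup e 0" "0 \<le> x" using x by auto
    interpret normal_subset ?P using arch k(1) by (rule archimedean_normal_polar)
    have "sup s 0 \<in> ?P"
      using lgroup_disjoint_mono[OF lgroup_pos_neg_disjoint[of s] k(1)] by (simp add: inf_commute)
    moreover have "e + z \<le> sup s 0 + (z + e)" by (metis s_def lgroup_diff_le_iff sup.cobounded1)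
    ultimately have "le_mod ?P (e + z) (z + e)" unfolding le_mod_def by blast
    then have "le_mod ?P (nmult n e + nmult n z) (nmult n (z + e))" for n
      by (rule le_mod_nmult_add)
    moreover have "nmult n (z + e) \<le> x + nmult n z" for n
    proof -
      have "z + e = x + z - x" by (simp add: z_def e_def add.assoc[symmetric] add_diff_eq)
      then have "nmult n (z + e) = x + nmult n z - x"
        using nmult_conj[of n "- x" z] by simp
      then show ?thesis using x by (simp add: lgroup_diff_nonneg_le)
    qed
    ultimately show "le_mod ?P (nmult n e) x" for n
      using le_mod_right le_mod_trans le_modI by meson
  qed
  \<comment> \<open>By the first case, the negative part of \<open>s\<close> is negligible modulo
    the polar of \<open>sup e 0\<close>, so only the case "z + e below e + z" remains there.\<close>
  then have "sup (- s) 0 \<in> {q. 0 \<le> q \<and> inf (sup e 0) q = 0}" by simp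
  moreover have "z + e \<le> sup (- s) 0 + (e + z)"
    unfolding lgroup_diff_le_iff[symmetric] by (simp add: s_def)
  ultimately have ze: "le_mod {q. 0 \<le> q \<and> inf (sup e 0) q = 0} (z + e) (e + z)"
    unfolding le_mod_def by blast
  have "sup e 0 = 0"
  proof (rule vanish[of _ c])
    let ?P = "{q. 0 \<le> q \<and> inf (sup e 0) q = 0}"
    interpret normal_subset ?P using arch by (rule archimedean_normal_polar) simp
    have "le_mod ?P (nmult n z + nmult n e) (nmult n (e + z))" for n
      using ze by (rule le_mod_nmult_add)
    moreover have "nmult n (e + z) \<le> nmult n z + c" for n
    proof -
      have "e + z = - c + z + c" by (simp add: z_def e_def add.assoc[symmetric] add_diff_eq)
      then have "nmult n (e + z) = - c + (nmult n z + c)"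
        using nmult_conj[of n c z] by (simp add: add.assoc)
      then show ?thesis using c
        by (simp add: lgroup_uminus_add_le_iff lgroup_le_add_left)
    qed
    ultimately show "le_mod ?P (nmult n e) c" for n
      using le_mod_left le_mod_trans le_modI by meson
  qed (use c in auto)
  then show ?thesis unfolding e_def by (metis sup.cobounded1)
qed

text \<open>For nonnegative elements, the commutator inequality is applied in both orders. The
  general case follows by writing first one argument and then the other as a difference of
  nonnegative elements.\<close>

theorem archimedean_commute:
  fixes a b :: "'a::lgroup"
  assumes arch: "archimedean TYPE('a)"
  shows "a + b = b + a"
proof -
  have le: "x + c \<le> c + x" if "0 \<le> c" "0 \<le> x" for c x :: 'a
    using archimedean_commutator_nonpos[OF arch that]
    by (simp add: lgroup_diff_le_iff lgroup_uminus_add_le_iff add.assoc)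
  have pos: "x + c = c + x" if "0 \<le> c" "0 \<le> x" for c x :: 'a
    using le that by (simp add: order.antisym)
  have neg: "x - c = - c + x" if "x + c = c + x" for c x :: 'a
    using that by (metis add.assoc add_diff_cancel minus_add_cancel)
  have dec: "\<exists>x y. 0 \<le> x \<and> 0 \<le> y \<and> a = x - y" for a :: 'a
    using lgroup_pos_neg_eq[of a] by (metis add_diff_cancel sup.cobounded2)
  have half: "a + c = c + a" if c: "0 \<le> c" for a c :: 'a
  proof -
    obtain x y where a: "0 \<le> x" "0 \<le> y" "a = x - y" using dec by blast
    have "x - y + c = x + (c - y)" using neg[OF pos[OF a(2) c]] by (simp add: add.assoc diff_conv_add_uminus del: add_uminus_conv_diff)
    also have "\<dots> = c + (x - y)" using pos[OF c a(1)] by (metis add.assoc add_diff_eq)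
    finally show ?thesis using a by simp
  qed
  obtain x y where b: "0 \<le> x" "0 \<le> y" "b = x - y" using dec by blast
  have "a + (x - y) = x + (a - y)" using half[OF b(1), of a] by (metis add.assoc add_diff_eq)
  also have "\<dots> = x - y + a" using neg[OF half[OF b(2), of a]] by (simp add: add.assoc diff_conv_add_uminus del: add_uminus_conv_diff)
  finally show ?thesis using b by simp
qed


section \<open>Convex l-subgroups and polars\<close>

text \<open>Solidity replaces the remaining closure conditions: joins, meets and elements between
  \<open>a\<close> and \<open>b\<close> all lie, together with their negatives, below
  \<open>labs a + labs b\<close>.\<close>

lemma convex_lsubgroupI:
  fixes H :: "'a::lgroup set"
  assumes zero: "0 \<in> H" and add: "\<And>x y. x \<in> H \<Longrightarrow> y \<in> H \<Longrightarrow> x + y \<in> H"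
    and solid: "\<And>x y. y \<in> H \<Longrightarrow> labs x \<le> labs y \<Longrightarrow> x \<in> H"
  shows "convex_lsubgroup H"
proof -
  have between: "x \<in> H" if ab: "a \<in> H" "b \<in> H" "x \<le> labs a + labs b" "- x \<le> labs a + labs b" for a b x
  proof (rule solid)
    show "labs a + labs b \<in> H" using ab solid[of a "labs a"] solid[of b "labs b"] add by simp
    show "labs x \<le> labs (labs a + labs b)" using ab by (simp add: labs_le_iff lgroup_add_nonneg)
  qed
  have le: "y \<le> labs a + labs b" if "y \<le> labs a \<or> y \<le> labs b" for a b y :: 'a
    using that lgroup_le_add_right[of "labs b" "labs a"] lgroup_le_add_left[of "labs a" "labs b"]
    by (auto intro: order_trans)
  note bounds = le_labs neg_le_labs le
  show ?thesis
    unfolding convex_lsubgroup_def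
  proof (intro conjI ballI allI impI)
    show "- a \<in> H" if "a \<in> H" for a using solid[OF that, of "- a"] by simp
    show "sup a b \<in> H" if "a \<in> H" "b \<in> H" for a b
    proof (rule between[OF that])
      show "sup a b \<le> labs a + labs b" by (simp add: bounds)
      have "- sup a b \<le> - a" by (simp add: lgroup_uminus_sup)
      then show "- sup a b \<le> labs a + labs b" by (meson bounds order_trans)
    qed
    show "inf a b \<in> H" if "a \<in> H" "b \<in> H" for a b
    proof (rule between[OF that])
      have "inf a b \<le> a" by simp
      then show "inf a b \<le> labs a + labs b" by (meson bounds order_trans)
      show "- inf a b \<le> labs a + labs b" by (simp add: bounds lgroup_uminus_inf)
    qed
    show "x \<in> H" if "a \<in> H" "b \<in> H" "a \<le> x" "x \<le> b" for a b x
    proof (rule between[OF that(1,2)])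
      show "x \<le> labs a + labs b" using that by (meson bounds order_trans)
      have "- x \<le> - a" using that by simp
      then show "- x \<le> labs a + labs b" by (meson bounds order_trans)
    qed
  qed (use zero add in auto)
qed

lemma convex_lsubgroup_zero: "convex_lsubgroup H \<Longrightarrow> 0 \<in> H"
  and convex_lsubgroup_add: "convex_lsubgroup H \<Longrightarrow> a \<in> H \<Longrightarrow> b \<in> H \<Longrightarrow> a + b \<in> H"
  unfolding convex_lsubgroup_def by blast+

lemma convex_lsubgroup_labs: "convex_lsubgroup H \<Longrightarrow> a \<in> H \<Longrightarrow> labs a \<in> H"
  unfolding convex_lsubgroup_def labs_def by blast

lemma convex_lsubgroup_labs_le: "convex_lsubgroup H \<Longrightarrow> y \<in> H \<Longrightarrow> labs x \<le> y \<Longrightarrow> x \<in> H"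
proof -
  assume H: "convex_lsubgroup H" and y: "y \<in> H" "labs x \<le> y"
  have "x \<le> y" "- y \<le> x"
    using y lgroup_neg_le_iff[of x "- y"] by (simp_all add: labs_le_iff)
  moreover have "- y \<in> H" using H y unfolding convex_lsubgroup_def by blast
  ultimately show "x \<in> H" using H y unfolding convex_lsubgroup_def by blast
qed

lemma convex_lsubgroup_le: "convex_lsubgroup H \<Longrightarrow> y \<in> H \<Longrightarrow> 0 \<le> x \<Longrightarrow> x \<le> y \<Longrightarrow> x \<in> H"
  using convex_lsubgroup_labs_le[of H y x] by simp

lemma convex_lsubgroup_labs_iff: "convex_lsubgroup H \<Longrightarrow> labs a \<in> H \<longleftrightarrow> a \<in> H"
  using convex_lsubgroup_labs convex_lsubgroup_labs_le by blast

lemma convex_lsubgroup_nmult: "convex_lsubgroup H \<Longrightarrow> a \<in> H \<Longrightarrow> nmult n a \<in> H"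
  by (induction n) (simp_all add: convex_lsubgroup_zero convex_lsubgroup_add)

section \<open>Polars, principal convex subgroups and property (M)\<close>

lemma convex_lsubgroup_polar: "convex_lsubgroup (polar S)" for S :: "'a::lgroup set"
proof (rule convex_lsubgroupI)
  show "0 \<in> polar S" by (simp add: polar_def inf_absorb1)
next
  fix x y assume xy: "x \<in> polar S" "y \<in> polar S"
  have "inf (labs (x + y)) (labs s) = 0" if "s \<in> S" for s
  proof -
    have "inf (labs s) (labs x + labs y + labs x) = 0"
      using xy that by (simp add: polar_def lgroup_disjoint_add inf_commute)
    then show ?thesis
      using lgroup_disjoint_mono[OF _ labs_nonneg labs_add_le] by (simp add: inf_commute)
  qed
  then show "x + y \<in> polar S" by (simp add: polar_def)
next
  fix x y assume "y \<in> polar S" "labs x \<le> labs y"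
  then show "x \<in> polar S"
    using lgroup_disjoint_mono[OF _ labs_nonneg] by (auto simp: polar_def inf_commute)
qed

lemma polar_labs_iff [simp]: "labs x \<in> polar S \<longleftrightarrow> x \<in> polar S"
  by (simp add: polar_def)

lemma polar_singleton_labs [simp]: "polar {labs a} = polar {a}"
  by (simp add: polar_def)

lemma weak_unit_polar_polar: "weak_unit v \<Longrightarrow> polar (polar {v}) = UNIV"
proof -
  assume "weak_unit v"
  then have "polar {v} = {0}" by (simp add: weak_unit_def)
  then show ?thesis by (simp add: polar_def inf_absorb2)
qed

lemma convex_lsubgroup_principal: "convex_lsubgroup (principal_lsub a)" for a :: "'a::lgroup"
proof (rule convex_lsubgroupI)
  show "0 \<in> principal_lsub a" by (auto simp: principal_lsub_def intro: exI[of _ 0])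
next
  fix x y assume "x \<in> principal_lsub a" "y \<in> principal_lsub a"
  then obtain m n where "labs x \<le> nmult m (labs a)" "labs y \<le> nmult n (labs a)"
    by (auto simp: principal_lsub_def)
  then have "labs x + labs y + labs x \<le> nmult (m + n + m) (labs a)"
    by (simp add: nmult_add lgroup_add_mono)
  then show "x + y \<in> principal_lsub a"
    unfolding principal_lsub_def using labs_add_le order_trans by blast
next
  fix x y assume "y \<in> principal_lsub a" "labs x \<le> labs y"
  then show "x \<in> principal_lsub a" unfolding principal_lsub_def using order_trans by blast
qed

lemma principal_lsub_self: "a \<in> principal_lsub a"
  unfolding principal_lsub_def by (auto intro: exI[of _ 1])

lemma principal_lsub_labs [simp]: "principal_lsub (labs a) = principal_lsub a"
  by (simp add: principal_lsub_def)

lemma principal_lsub_subset: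
  assumes H: "convex_lsubgroup H" and a: "a \<in> H"
  shows "principal_lsub a \<subseteq> H"
  unfolding principal_lsub_def
  using convex_lsubgroup_labs_le[OF H convex_lsubgroup_nmult[OF H convex_lsubgroup_labs[OF H a]]] by blast

text \<open>It suffices to test principal subgroups, since any convex l-subgroup containing
  \<open>a\<close> contains \<open>principal_lsub a\<close>. Passing to absolute values reduces to
  nonnegative elements.\<close>

lemma property_M_iff:
  "property_M TYPE('a::lgroup) \<longleftrightarrow>
     (\<forall>a b::'a. 0 \<le> a \<longrightarrow> 0 \<le> b \<longrightarrow> b \<in> polar (polar {a}) \<longrightarrow> b \<in> principal_lsub a)"
proof
  assume "property_M TYPE('a)"
  then show "\<forall>a b::'a. 0 \<le> a \<longrightarrow> 0 \<le> b \<longrightarrow> b \<in> polar (polar {a}) \<longrightarrow> b \<in> principal_lsub a"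
    using convex_lsubgroup_principal principal_lsub_self
    unfolding property_M_def d_subgroup_def by blast
next
  assume *: "\<forall>a b::'a. 0 \<le> a \<longrightarrow> 0 \<le> b \<longrightarrow> b \<in> polar (polar {a}) \<longrightarrow> b \<in> principal_lsub a"
  show "property_M TYPE('a)"
    unfolding property_M_def d_subgroup_def
  proof (intro allI impI conjI ballI subsetI)
    fix H :: "'a set" and a b
    assume H: "convex_lsubgroup H" "a \<in> H" "b \<in> polar (polar {a})"
    then have "labs b \<in> principal_lsub (labs a)" using *[rule_format, of "labs a" "labs b"] by simp
    then show "b \<in> H"
      using principal_lsub_subset[OF H(1,2)] convex_lsubgroup_labs_iff[OF H(1)] by auto
  qed
qed

section \<open>Existence of values and their relation to maximal subgroups\<close>

lemma YG_D: "p \<in> YG u \<Longrightarrow> convex_lsubgroup p" "p \<in> YG u \<Longrightarrow> u \<notin> p"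
  by (simp_all add: YG_def)

lemma YG_extend:
  assumes H: "convex_lsubgroup H" "u \<notin> H"
  obtains p where "p \<in> YG u" "H \<subseteq> p"
proof -
  let ?A = "{q. convex_lsubgroup q \<and> H \<subseteq> q \<and> u \<notin> q}"
  have "\<exists>M\<in>?A. \<forall>X\<in>?A. M \<subseteq> X \<longrightarrow> X = M"
  proof (rule subset_Zorn_nonempty)
    show "?A \<noteq> {}" using H by blast
  next
    fix C assume C: "C \<noteq> {}" "subset.chain ?A C"
    then have conv: "convex_lsubgroup q" if "q \<in> C" for q
      using that by (auto simp: subset.chain_def)
    have "convex_lsubgroup (\<Union>C)"
    proof (rule convex_lsubgroupI)
      show "0 \<in> \<Union>C" using C conv convex_lsubgroup_zero by blast
    next
      fix x y assume "x \<in> \<Union>C" "y \<in> \<Union>C"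
      then obtain q r where qr: "q \<in> C" "r \<in> C" "x \<in> q" "y \<in> r" by blast
      then have "q \<subseteq> r \<or> r \<subseteq> q" using C(2) unfolding subset.chain_def by blast
      then show "x + y \<in> \<Union>C" using qr conv convex_lsubgroup_add by blast
    next
      fix x y assume "y \<in> \<Union>C" "labs x \<le> labs y"
      then show "x \<in> \<Union>C" using conv convex_lsubgroup_labs_le convex_lsubgroup_labs by blast
    qed
    then show "\<Union>C \<in> ?A" using C by (auto simp: subset.chain_def)
  qed
  then obtain M where M: "M \<in> ?A" "\<forall>X\<in>?A. M \<subseteq> X \<longrightarrow> X = M" by (rule bexE)
  have "u \<in> q" if q: "convex_lsubgroup q" "M \<subset> q" for q
  proof (rule ccontr)
    assume "u \<notin> q"
    then have "q \<in> ?A" using M(1) q by blast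
    then show False using M(2) q(2) by blast
  qed
  then have "M \<in> YG u" using M(1) unfolding YG_def by blast
  then show thesis using that M(1) by blast
qed

text \<open>When \<open>u\<close> is strong, a convex l-subgroup is proper exactly if it omits
  \<open>u\<close>, so the two maximality conditions coincide.\<close>

lemma Max_lsub_strong_unit:
  assumes "strong_unit u"
  shows "Max_lsub = YG u"
proof -
  have iff: "u \<in> q \<longleftrightarrow> q = UNIV" if "convex_lsubgroup q" for q
    using principal_lsub_subset[OF that, of u] assms unfolding strong_unit_def by blast
  then show ?thesis unfolding Max_lsub_def YG_def by blast
qed

section \<open>Values of a weak unit\<close>

locale archimedean_lgroup =
  fixes ty :: "'a::lgroup itself"
  assumes arch: "archimedean TYPE('a)"
begin

lemmas commute = archimedean_commute[OF arch]

lemma left_commute: "a + (b + c) = b + (a + c)" for a b c :: 'a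
  by (metis add.assoc commute)

lemmas ac = add.assoc commute left_commute

text \<open>The elements bounded by some \<open>q + nmult n a\<close> with \<open>q\<close> in
  \<open>p\<close> form a convex l-subgroup strictly above \<open>p\<close>; commutativity serves to
  collect the summands. Maximality of \<open>p\<close> then puts \<open>u\<close> into it.\<close>

lemma YG_adjoin:
  fixes u :: 'a
  assumes u: "0 \<le> u" and p: "p \<in> YG u" and a: "0 \<le> a" "a \<notin> p"
  obtains q n where "q \<in> p" "0 \<le> q" "u \<le> q + nmult n a"
proof -
  note conv = YG_D(1)[OF p]
  let ?H = "{x. \<exists>q\<in>p. \<exists>n. labs x \<le> q + nmult n a}"
  have "convex_lsubgroup ?H"
  proof (rule convex_lsubgroupI)
    show "0 \<in> ?H" using convex_lsubgroup_zero[OF conv] by (auto intro!: bexI[of _ 0] exI[of _ 0])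
  next
    fix x y assume "x \<in> ?H" "y \<in> ?H"
    then obtain q r m n where *: "q \<in> p" "r \<in> p" "labs x \<le> q + nmult m a" "labs y \<le> r + nmult n a"
      by blast
    have "labs (x + y) \<le> labs x + labs y + labs x" by (rule labs_add_le)
    also have "\<dots> \<le> (q + nmult m a) + (r + nmult n a) + (q + nmult m a)"
      using * by (intro lgroup_add_mono)
    also have "\<dots> = (q + r + q) + nmult (m + n + m) a" by (simp add: nmult_add ac)
    finally show "x + y \<in> ?H" using * convex_lsubgroup_add[OF conv] by blast
  next
    fix x y assume "y \<in> ?H" "labs x \<le> labs y"
    then show "x \<in> ?H" using order_trans by blast
  qed
  moreover have "p \<subset> ?H"
  proof
    show "p \<subseteq> ?H"
      using convex_lsubgroup_labs[OF conv] by (auto intro!: bexI[of _ "labs _"] exI[of _ 0])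
    have "a \<in> ?H"
      using a convex_lsubgroup_zero[OF conv] by (auto intro!: bexI[of _ 0] exI[of _ 1])
    then show "p \<noteq> ?H" using a by blast
  qed
  ultimately have "u \<in> ?H" using p unfolding YG_def by blast
  then obtain q n where q: "q \<in> p" "u \<le> q + nmult n a" using u by auto
  then have "u \<le> labs q + nmult n a" 
    by (intro order_trans[OF _ lgroup_add_right_mono[OF le_labs]])
  then show thesis using that convex_lsubgroup_labs[OF conv q(1)] by simp
qed

text \<open>If both elements were outside \<open>p\<close>, adjoining each would bound
  \<open>u\<close> by \<open>q + r\<close> plus a multiple of \<open>a\<close> and by
  \<open>q + r\<close> plus a multiple of \<open>b\<close>. These multiples are disjoint, so
  \<open>u \<le> q + r\<close>, which lies in \<open>p\<close>.\<close>

lemma YG_prime: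
  fixes u :: 'a
  assumes u: "0 \<le> u" and p: "p \<in> YG u" and ab: "inf a b = 0"
  shows "a \<in> p \<or> b \<in> p"
proof (rule ccontr)
  assume n: "\<not> (a \<in> p \<or> b \<in> p)"
  have pos: "0 \<le> a" "0 \<le> b" using ab by (metis inf.cobounded1 inf.cobounded2)+
  obtain q m where q: "q \<in> p" "0 \<le> q" "u \<le> q + nmult m a"
    using YG_adjoin[OF u p pos(1)] n by blast
  obtain r n where r: "r \<in> p" "0 \<le> r" "u \<le> r + nmult n b"
    using YG_adjoin[OF u p pos(2)] n by blast
  have dis: "inf (nmult m a) (nmult n b) = 0"
    using ab nmult_disjoint inf_commute by metis
  have "u \<le> (q + r) + nmult m a"
    by (rule order_trans[OF q(3) lgroup_add_right_mono[OF lgroup_le_add_right[OF r(2)]]])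
  moreover have "u \<le> (q + r) + nmult n b"
    by (rule order_trans[OF r(3) lgroup_add_right_mono[OF lgroup_le_add_left[OF q(2)]]])
  ultimately have "u \<le> (q + r) + inf (nmult m a) (nmult n b)" by (simp add: lgroup_add_inf_left)
  then have "u \<le> q + r" using dis by simp
  then show False
    using convex_lsubgroup_le convex_lsubgroup_add YG_D[OF p] q(1) r(1) u by blast
qed

text \<open>Some multiple \<open>n b\<close> is not below \<open>u\<close>, so the positive part
  \<open>c\<close> of \<open>n b - u\<close> is nonzero and the weak unit is outside
  \<open>polar {c}\<close>. A value above \<open>polar {c}\<close> contains the negative part
  \<open>d\<close>; if it contained \<open>b\<close>, then \<open>u \<le> d + n b\<close> would put
  \<open>u\<close> into it.\<close>

lemma YG_separation:
  fixes u b :: 'a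
  assumes u: "weak_unit u" and b: "0 \<le> b" "b \<noteq> 0"
  obtains p where "p \<in> YG u" "b \<notin> p"
proof -
  have u0: "0 \<le> u" using u by (simp add: weak_unit_def)
  obtain n where n: "\<not> nmult n b \<le> u" using arch b u0 unfolding archimedean_def by blast
  define c where "c = sup (nmult n b - u) 0"
  define d where "d = sup (u - nmult n b) 0"
  have "c \<noteq> 0"
    using n lgroup_diff_le_iff[of "nmult n b" u 0] unfolding c_def by (metis add_0 sup.cobounded1)
  then have "c \<notin> polar {u}" using u by (simp add: weak_unit_def)
  then have "u \<notin> polar {c}" by (simp add: polar_def inf_commute)
  then obtain p where p: "p \<in> YG u" "polar {c} \<subseteq> p"
    by (rule YG_extend[OF convex_lsubgroup_polar])
  have "inf d c = 0"
    using lgroup_pos_neg_disjoint[of "nmult n b - u"] by (simp add: c_def d_def inf_commute)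
  then have "d \<in> polar {c}" by (simp add: polar_def c_def d_def)
  then have d: "d \<in> p" using p by blast
  have "u \<le> d + nmult n b"
    unfolding lgroup_diff_le_iff[symmetric] d_def by simp
  then have "b \<notin> p"
    using d YG_D[OF p(1)] u0 convex_lsubgroup_le convex_lsubgroup_add convex_lsubgroup_nmult by blast
  then show thesis using that p by blast
qed

text \<open>Converse to primeness: a nonzero meet would be omitted by some value, which by convexity
  omits both elements.\<close>

lemma disjoint_if_YG:
  fixes u x y :: 'a
  assumes u: "weak_unit u" and xy: "0 \<le> x" "0 \<le> y" "\<And>p. p \<in> YG u \<Longrightarrow> x \<in> p \<or> y \<in> p"
  shows "inf x y = 0"
proof (rule ccontr)
  assume "inf x y \<noteq> 0"
  then obtain p where p: "p \<in> YG u" "inf x y \<notin> p" using YG_separation[OF u, of "inf x y"] xy by auto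
  then have "x \<notin> p" "y \<notin> p"
    using convex_lsubgroup_le[OF YG_D(1)[OF p(1)], of x "inf x y"]
      convex_lsubgroup_le[OF YG_D(1)[OF p(1)], of y "inf x y"] xy(1,2) p(2) by auto
  then show False using xy p by blast
qed

section \<open>Cozero sets and the topology of the Yosida space\<close>

lemma coz_nonneg:
  fixes u a :: 'a
  assumes u: "0 \<le> u" and a: "0 \<le> a"
  shows "coz u a = {p \<in> YG u. a \<notin> p}"
proof -
  have "yosida u a p = 0 \<longleftrightarrow> a \<in> p" if p: "p \<in> YG u" for p
  proof
    note conv = YG_D(1)[OF p]
    assume ap: "a \<in> p"
    show "yosida u a p = 0"
      unfolding yosida_def
    proof (rule antisym[OF Sup_least Sup_upper])
      fix x assume "x \<in> {ereal (real_of_int m / real n) | m n.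
            0 < n \<and> sup (zmult m u - nmult n a) 0 \<in> p}"
      then obtain m n where x: "x = ereal (real_of_int m / real n)" "0 < n"
        "sup (zmult m u - nmult n a) 0 \<in> p" by blast
      \<comment> \<open>A positive numerator gives \<open>u \<le> zmult m u\<close>, which is
        bounded by a sum of elements of \<open>p\<close>, although \<open>u\<close> is outside
        \<open>p\<close>.\<close>
      have "m \<le> 0"
      proof (rule ccontr)
        assume m: "\<not> m \<le> 0"
        then obtain k where k: "nat m = Suc k" by (metis not0_implies_Suc nat_0_iff)
        have "u \<le> zmult m u" using m k u by (simp add: zmult_def lgroup_le_add_right)
        also have "\<dots> \<le> sup (zmult m u - nmult n a) 0 + nmult n a"
          unfolding lgroup_diff_le_iff[symmetric] by simp
        finally show False
          using YG_D[OF p] u x(3) ap convex_lsubgroup_le convex_lsubgroup_add convex_lsubgroup_nmult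
          by blast
      qed
      then show "x \<le> 0" using x by (simp add: divide_nonpos_pos)
    next
      \<comment> \<open>The fraction 0/1 is admissible because \<open>a\<close> is nonnegative, so
        the supremum is at least 0.\<close>
      have "sup (zmult 0 u - nmult 1 a) 0 = 0" using a by (simp add: zmult_def sup_absorb2)
      then show "0 \<in> {ereal (real_of_int m / real n) | m n.
            0 < n \<and> sup (zmult m u - nmult n a) 0 \<in> p}"
        using convex_lsubgroup_zero[OF conv]
        by (intro CollectI exI[of _ "0::int"] exI[of _ "1::nat"]) (simp add: zero_ereal_def)
    qed
  next
    assume y: "yosida u a p = 0"
    show "a \<in> p"
    proof (rule ccontr)
      assume "a \<notin> p"
      then obtain q n where q: "q \<in> p" "0 \<le> q" "u \<le> q + nmult n a" using YG_adjoin u p a by blast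
      \<comment> \<open>For \<open>n = 0\<close> the bound would put \<open>u\<close> below
        \<open>q\<close>, hence into \<open>p\<close>. So 1/n is an admissible fraction and the
        value at \<open>p\<close> is positive.\<close>
      have "n \<noteq> 0" using q u YG_D[OF p] convex_lsubgroup_le[of p q u] by (cases n) auto
      have "sup (zmult 1 u - nmult n a) 0 \<le> q"
        using q by (simp add: zmult_def lgroup_diff_le_iff)
      then have "sup (zmult 1 u - nmult n a) 0 \<in> p"
        using convex_lsubgroup_le[OF YG_D(1)[OF p] q(1)] by simp
      then have "ereal (real_of_int 1 / real n) \<le> yosida u a p"
        unfolding yosida_def using \<open>n \<noteq> 0\<close> by (intro Sup_upper) blast
      then show False using y \<open>n \<noteq> 0\<close> by (simp add: zero_ereal_def)
    qed
  qed
  then show ?thesis unfolding coz_def by blast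
qed

text \<open>The generating sets already form a base: a binary intersection is handled by the meet of
  two nonnegative elements, which stays outside \<open>p\<close> by primeness.\<close>

lemma yosida_space_base:
  fixes u :: 'a
  assumes u: "0 \<le> u" and T: "openin (yosida_space u) T" and p: "p \<in> T"
  obtains x where "0 \<le> x" "x \<notin> p" "{q \<in> YG u. x \<notin> q} \<subseteq> T"
proof -
  have "T \<subseteq> YG u" using openin_subset[OF T] by simp
  have "generate_topology_on {{p \<in> YG u. a \<notin> p} | a. True} T"
    using T unfolding yosida_space_def by (simp add: openin_topology_generated_by_iff)
  then have "p \<in> T \<Longrightarrow> \<exists>x. 0 \<le> x \<and> x \<notin> p \<and> {q \<in> YG u. x \<notin> q} \<subseteq> T"
  proof induction
    case Empty
    then show ?case by simp
  next
    case (Int A B)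
    then obtain x y where xy: "0 \<le> x" "x \<notin> p" "{q \<in> YG u. x \<notin> q} \<subseteq> A"
      "0 \<le> y" "y \<notin> p" "{q \<in> YG u. y \<notin> q} \<subseteq> B" by auto
    let ?z = "inf x y"
    have pY: "p \<in> YG u" using \<open>p \<in> T\<close> \<open>T \<subseteq> YG u\<close> by blast
    \<comment> \<open>One of these disjoint differences lies in \<open>p\<close>; if
      \<open>?z\<close> did too, so would \<open>x\<close> or \<open>y\<close>.\<close>
    have "inf (x - ?z) (y - ?z) = 0"
      using lgroup_add_inf_right[of x y "- ?z"] by simp
    then have "x - ?z \<in> p \<or> y - ?z \<in> p" using YG_prime u pY by blast
    then have "?z \<notin> p"
      using xy convex_lsubgroup_add[OF YG_D(1)[OF pY], of "_ - ?z" ?z] by auto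
    moreover have "{q \<in> YG u. ?z \<notin> q} \<subseteq> A \<inter> B"
      using xy convex_lsubgroup_le[OF YG_D(1), of _ u _ ?z] by fastforce
    ultimately show ?case using xy by (intro exI[of _ ?z]) simp
  next
    case (UN K)
    then obtain k where k: "k \<in> K" "p \<in> k" by blast
    obtain x where "0 \<le> x" "x \<notin> p" "{q \<in> YG u. x \<notin> q} \<subseteq> k" using UN.IH[OF k] by (elim exE conjE)
    with k(1) show ?case by (intro exI[of _ x]) auto
  next
    case (Basis s)
    then obtain a where a: "s = {q \<in> YG u. a \<notin> q}" by blast
    have "a \<in> q \<longleftrightarrow> labs a \<in> q" if "q \<in> YG u" for q
      using convex_lsubgroup_labs_iff[OF YG_D(1)[OF that]] by simp
    then show ?case using a Basis by (intro exI[of _ "labs a"]) auto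
  qed
  then show thesis using that p by blast
qed

text \<open>Forward: if a value omits both \<open>b\<close> and \<open>labs h\<close>, the
  neighbourhood given by \<open>labs h\<close> meets the cozero set of \<open>a\<close>, against
  primeness and disjointness of \<open>h\<close> from \<open>a\<close>. Backward: a point of
  \<open>coz u b\<close> outside the closure has a basic neighbourhood, given by some
  \<open>x\<close>, that misses \<open>coz u a\<close>. So \<open>x\<close> is disjoint from
  \<open>a\<close> and hence from \<open>b\<close>, while both \<open>x\<close> and \<open>b\<close>
  are outside the prime \<open>p\<close>.\<close>

lemma coz_subset_closure_iff:
  fixes u a b :: 'a
  assumes u: "weak_unit u" and a: "0 \<le> a" and b: "0 \<le> b"
  shows "coz u b \<subseteq> yosida_space u closure_of coz u a \<longleftrightarrow> b \<in> polar (polar {a})"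
proof -
  have u0: "0 \<le> u" using u by (simp add: weak_unit_def)
  note coz = coz_nonneg[OF u0 a] coz_nonneg[OF u0 b]
  show ?thesis
  proof
    assume cl: "coz u b \<subseteq> yosida_space u closure_of coz u a"
    have "inf b (labs h) = 0" if h: "h \<in> polar {a}" for h
    proof (rule disjoint_if_YG[OF u b labs_nonneg])
      fix p assume p: "p \<in> YG u"
      show "b \<in> p \<or> labs h \<in> p"
      proof (rule ccontr)
        assume n: "\<not> (b \<in> p \<or> labs h \<in> p)"
        then have "p \<in> yosida_space u closure_of coz u a" using cl p coz(2) by auto
        then have meets: "\<exists>q\<in>coz u a. q \<in> T" if "p \<in> T" "openin (yosida_space u) T" for T
          using that by (auto simp: in_closure_of)
        have "openin (yosida_space u) {q \<in> YG u. labs h \<notin> q}"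
          unfolding yosida_space_def by (rule topology_generated_by_Basis) blast
        with meets[of "{q \<in> YG u. labs h \<notin> q}"] obtain q
          where "q \<in> YG u" "a \<notin> q" "labs h \<notin> q"
          using n p coz(1) by auto
        moreover have "inf (labs h) a = 0" using h a by (simp add: polar_def)
        ultimately show False using YG_prime[OF u0] by blast
      qed
    qed
    then show "b \<in> polar (polar {a})" using b by (simp add: polar_def)
  next
    assume bp: "b \<in> polar (polar {a})"
    show "coz u b \<subseteq> yosida_space u closure_of coz u a"
    proof
      fix p assume "p \<in> coz u b"
      then have p: "p \<in> YG u" "b \<notin> p" using coz by auto
      have "\<exists>y\<in>coz u a. y \<in> T" if T: "p \<in> T" "openin (yosida_space u) T" for T
      proof (rule ccontr)
        assume none: "\<not> (\<exists>y\<in>coz u a. y \<in> T)"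
        obtain x where x: "0 \<le> x" "x \<notin> p" "{q \<in> YG u. x \<notin> q} \<subseteq> T"
          using yosida_space_base[OF u0 T(2,1)] .
        have "inf x a = 0"
          by (rule disjoint_if_YG[OF u x(1) a]) (use x(3) none coz(1) in auto)
        then have "x \<in> polar {a}" using x a by (simp add: polar_def)
        then have "inf (labs b) (labs x) = 0" using bp unfolding polar_def[of "polar {a}"] by blast
        then have "inf b x = 0" using b x(1) by simp
        then show False using YG_prime[OF u0 p(1)] p(2) x(2) by blast
      qed
      then show "p \<in> yosida_space u closure_of coz u a"
        using p(1) unfolding in_closure_of by auto
    qed
  qed
qed

section \<open>Implications between the four conditions\<close>

lemma property_M_weak_unit_strong:
  fixes v :: 'a
  assumes "property_M TYPE('a)" "weak_unit v"
  shows "strong_unit v"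
proof -
  have v: "0 \<le> v" "polar {v} = {0}" using assms by (simp_all add: weak_unit_def)
  have "polar (polar {v}) = UNIV" using assms(2) by (rule weak_unit_polar_polar)
  then have "b \<in> principal_lsub v" if "0 \<le> b" for b
    using assms(1) v(1) that unfolding property_M_iff by blast
  then have "labs b \<in> principal_lsub v" for b by simp
  then show ?thesis
    using v(1) convex_lsubgroup_labs_iff[OF convex_lsubgroup_principal] unfolding strong_unit_def by blast
qed

lemma property_M_Max_subset_Spec_d:
  fixes u :: 'a
  assumes M: "property_M TYPE('a)" and u: "weak_unit u"
  shows "(Max_lsub :: 'a set set) \<subseteq> Spec_d"
proof
  fix p :: "'a set" assume "p \<in> Max_lsub"
  then have p: "p \<in> YG u" using Max_lsub_strong_unit property_M_weak_unit_strong M u by blast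
  have "0 \<le> u" using u by (simp add: weak_unit_def)
  then have "prime_subgroup p"
    unfolding prime_subgroup_def using YG_D[OF p] YG_prime p by blast
  moreover have "d_subgroup p" using M YG_D[OF p] unfolding property_M_def by blast
  ultimately show "p \<in> Spec_d" by (simp add: Spec_d_def)
qed

text \<open>Let \<open>b\<close> lie in every value containing \<open>a\<close>, and let
  \<open>h\<close> be disjoint from \<open>a\<close>. By primeness each value contains
  \<open>a\<close>, hence \<open>b\<close>, or it contains \<open>h\<close>; so \<open>b\<close> is
  disjoint from \<open>h\<close>. Thus \<open>b\<close> is in the double polar of \<open>a\<close>,
  which (M) places inside \<open>principal_lsub a\<close>.\<close>

lemma property_M_property_Y:
  fixes u :: 'a
  assumes M: "property_M TYPE('a)" and u: "weak_unit u"
  shows "property_Y TYPE('a)"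
proof -
  have u0: "0 \<le> u" using u by (simp add: weak_unit_def)
  have max: "Max_lsub = YG u" using Max_lsub_strong_unit property_M_weak_unit_strong M u by blast
  have "principal_lsub a = \<Inter>{p \<in> Max_lsub. a \<in> p}" for a :: 'a
  proof
    show "principal_lsub a \<subseteq> \<Inter>{p \<in> Max_lsub. a \<in> p}"
      using principal_lsub_subset YG_D(1) unfolding max by blast
    show "\<Inter>{p \<in> Max_lsub. a \<in> p} \<subseteq> principal_lsub a"
    proof
      fix b assume b: "b \<in> \<Inter>{p \<in> Max_lsub. a \<in> p}"
      have "inf (labs b) (labs h) = 0" if h: "h \<in> polar {a}" for h
      proof (rule disjoint_if_YG[OF u labs_nonneg labs_nonneg])
        fix p assume p: "p \<in> YG u"
        have "inf (labs a) (labs h) = 0" using h by (simp add: polar_def inf_commute)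
        then have "a \<in> p \<or> labs h \<in> p"
          using YG_prime[OF u0 p] convex_lsubgroup_labs_iff[OF YG_D(1)[OF p]] by blast
        then show "labs b \<in> p \<or> labs h \<in> p"
          using b p convex_lsubgroup_labs[OF YG_D(1)[OF p]] unfolding max by blast
      qed
      then have "b \<in> polar (polar {a})" by (simp add: polar_def)
      then show "b \<in> principal_lsub a"
        using M convex_lsubgroup_principal principal_lsub_self
        unfolding property_M_def d_subgroup_def by blast
    qed
  qed
  then show ?thesis unfolding property_Y_def by (metis (no_types, lifting) mem_Collect_eq subsetI)
qed

text \<open>A member of the family \<open>F\<close> would be a d-subgroup containing
  \<open>v\<close>, hence would contain the double polar of \<open>v\<close>, which is everything.
  So \<open>F\<close> is empty and its intersection is the whole group.\<close>

lemma weak_unit_strong_if_Max_subset_Spec_d: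
  fixes v :: 'a
  assumes Y: "property_Y TYPE('a)" and sub: "(Max_lsub :: 'a set set) \<subseteq> Spec_d" and v: "weak_unit v"
  shows "strong_unit v"
proof -
  obtain F where F: "F \<subseteq> Max_lsub" "principal_lsub v = \<Inter>F"
    using Y unfolding property_Y_def by (elim allE[of _ v] exE conjE)
  have "F = {}"
  proof (rule ccontr)
    assume "F \<noteq> {}"
    then obtain p where p: "p \<in> Max_lsub" "v \<in> p" using F principal_lsub_self by blast
    then have "d_subgroup p" using sub by (auto simp: Spec_d_def)
    then have "polar (polar {v}) \<subseteq> p" using p by (simp add: d_subgroup_def)
    then have "p = UNIV" using weak_unit_polar_polar[OF v] by auto
    then show False using p(1) unfolding Max_lsub_def by blast
  qed
  then show ?thesis using F v by (simp add: strong_unit_def weak_unit_def)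
qed

text \<open>
  If \<open>b \<in> a\<^sup>\<bottom>\<^sup>\<bottom>\<close> is not in the maximal subgroup \<open>p\<close> containing \<open>a\<close>, then \<open>u \<le> q + n b\<close> with
  \<open>q \<in> p\<close>, and \<open>a + q \<in> p\<close> is a weak unit.
\<close>

lemma property_M_if_weak_unit_strong:
  fixes u :: 'a
  assumes Y: "property_Y TYPE('a)" and strong: "\<And>v::'a. weak_unit v \<Longrightarrow> strong_unit v"
    and u: "weak_unit u"
  shows "property_M TYPE('a)"
  unfolding property_M_iff
proof (intro allI impI, rule ccontr)
  fix a b :: 'a
  assume a: "0 \<le> a" and b: "0 \<le> b" "b \<in> polar (polar {a})" "b \<notin> principal_lsub a"
  have u0: "0 \<le> u" using u by (simp add: weak_unit_def)
  obtain F where F: "F \<subseteq> Max_lsub" "principal_lsub a = \<Inter>F"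
    using Y unfolding property_Y_def by (elim allE[of _ a] exE conjE)
  obtain p where "p \<in> F" "b \<notin> p" using b(3) F(2) by auto
  then have p: "p \<in> YG u" "a \<in> p" "b \<notin> p"
    using F principal_lsub_self[of a] Max_lsub_strong_unit[OF strong[OF u]] by auto
  obtain q n where q: "q \<in> p" "0 \<le> q" "u \<le> q + nmult n b" using YG_adjoin[OF u0 p(1) b(1) p(3)] .
  have nonneg: "0 \<le> a + q" using a q by (simp add: lgroup_add_nonneg)
  \<comment> \<open>Disjointness from \<open>a + q\<close> passes to \<open>a\<close> and
    \<open>q\<close>, then from \<open>a\<close> to \<open>b\<close> by the double polar, then to
    \<open>q + nmult n b\<close>, and finally to the weak unit \<open>u\<close> below it.\<close>
  have "h = 0" if h: "h \<in> polar {a + q}" for h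
  proof -
    have dis: "inf (labs h) (a + q) = 0" using h nonneg by (simp add: polar_def)
    have "inf (labs h) a = 0" "inf (labs h) q = 0"
      using lgroup_disjoint_mono[OF dis] a q by (simp_all add: lgroup_le_add_left lgroup_le_add_right)
    then have "h \<in> polar {a}" using a by (simp add: polar_def)
    then have "inf (labs b) (labs h) = 0" using b(2) unfolding polar_def[of "polar {a}"] by blast
    then have "inf (labs h) b = 0" using b(1) by (simp add: inf_commute)
    then have "inf (labs h) (q + nmult n b) = 0"
      using \<open>inf (labs h) q = 0\<close> by (simp add: lgroup_disjoint_add nmult_disjoint)
    then have "inf (labs h) u = 0" using lgroup_disjoint_mono u0 q(3) by blast
    then have "h \<in> polar {u}" using u0 by (simp add: polar_def)
    then show "h = 0" using u by (simp add: weak_unit_def)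
  qed
  then have "weak_unit (a + q)"
    using nonneg convex_lsubgroup_zero[OF convex_lsubgroup_polar] unfolding weak_unit_def by blast
  then have "principal_lsub (a + q) = UNIV" using strong by (simp add: strong_unit_def)
  moreover have "principal_lsub (a + q) \<subseteq> p"
    using principal_lsub_subset convex_lsubgroup_add YG_D(1) p q by blast
  ultimately show False using YG_D(2) p by blast
qed

end

theorem theorem5p11:
  fixes u :: "'a::lgroup"
  assumes "archimedean TYPE('a)"
    and "weak_unit u"
  shows
    "(property_M TYPE('a) \<longleftrightarrow>
        strong_unit u \<and>
        (\<forall>a b. 0 \<le> a \<longrightarrow> 0 \<le> b \<longrightarrow>
           coz u b \<subseteq> yosida_space u closure_of coz u a \<longrightarrow> b \<in> principal_lsub a)) \<and>
     (property_M TYPE('a) \<longleftrightarrow>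
        property_Y TYPE('a) \<and> (Max_lsub :: 'a set set) \<subseteq> Spec_d) \<and>
     (property_M TYPE('a) \<longleftrightarrow>
        property_Y TYPE('a) \<and> (\<forall>v::'a. weak_unit v \<longrightarrow> strong_unit v))"
proof -
  interpret archimedean_lgroup "TYPE('a)" using assms(1) by unfold_locales
  note u = assms(2)
  have strong: "\<forall>v::'a. weak_unit v \<longrightarrow> strong_unit v" if "property_M TYPE('a)"
    using property_M_weak_unit_strong[OF that] by simp
  \<comment> \<open>The cozero condition by itself is equivalent to (M); strength of
    \<open>u\<close> in (2) then comes from \<open>strong\<close>.\<close>
  have coz: "(\<forall>a b. 0 \<le> a \<longrightarrow> 0 \<le> b \<longrightarrow>
      coz u b \<subseteq> yosida_space u closure_of coz u a \<longrightarrow> b \<in> principal_lsub a) \<longleftrightarrow>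
    property_M TYPE('a)"
    unfolding property_M_iff by (simp add: coz_subset_closure_iff[OF u] cong: imp_cong)
  show ?thesis
    unfolding coz
  proof (intro conjI iffI; (elim conjE)?)
    assume M: "property_M TYPE('a)"
    show "strong_unit u" using strong[OF M] u by simp
    show "property_M TYPE('a)" by (rule M)
    show "property_Y TYPE('a)" using M u by (rule property_M_property_Y)
    then show "property_Y TYPE('a)" .
    show "(Max_lsub :: 'a set set) \<subseteq> Spec_d" using M u by (rule property_M_Max_subset_Spec_d)
    show "\<forall>v::'a. weak_unit v \<longrightarrow> strong_unit v" using M by (rule strong)
  next
    assume Y: "property_Y TYPE('a)" and "(Max_lsub :: 'a set set) \<subseteq> Spec_d"
    then have "strong_unit v" if "weak_unit v" for v :: 'a
      using that by (rule weak_unit_strong_if_Max_subset_Spec_d)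
    with Y show "property_M TYPE('a)" using u by (rule property_M_if_weak_unit_strong)
  next
    assume "property_Y TYPE('a)" "\<forall>v::'a. weak_unit v \<longrightarrow> strong_unit v"
    then show "property_M TYPE('a)" using property_M_if_weak_unit_strong u by simp
  qed
qed

end
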